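(* Let $n\ge 3$, let $D$ be a simple drawing of the complete graph $K_n$ in the sphere $\mathbb S^2$, and let $C$ be the simple closed curve bounding a face of $D$. If $e$ is any closed edge of $K_n$ (that is, the arc representing an edge in $D$, including its two end vertices), then $e\cap C$ is either connected or consists of exactly the two vertices incident with $e$.
   Context: Drawing: in a drawing $D$ of $K_n$ in the sphere $\mathbb S^2$, each vertex is represented by a distinct point of $\mathbb S^2$, and each edge is represented by an arc joining the points representing its two incident vertices. No edge contains a vertex-point in its interior, and any two edge-arcs have finitely many intersections, all of which are either common endpoints or crossings. More than two edges are allowed to cross at the same point. Vertices and edges are identified with the points and arcs representing them, and $D[K_n]$ denotes the union of all these points and arcs. Simple drawing: a drawing is simple if any two distinct closed edges have at most one point in common, this point being either a vertex (common endpoint) or a crossing. Face: a face of $D$ is a connected component of $\mathbb S^2\setminus D[K_n]$. It is a known fact that, for $n\ge 3$, each face of a simple drawing of $K_n$ is an open disc whose closure is a closed disc, so its boundary is a simple closed curve. Convention: the empty set is regarded as connected. *)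

theory Defs
  imports "HOL-Analysis.Analysis"
begin

abbreviation S2 :: "(real^3) set" where
  "S2 \<equiv> sphere 0 1"

definition complete_edges :: "nat \<Rightarrow> nat set set" where
  "complete_edges n = {e. e \<subseteq> {..<n} \<and> card e = 2}"

definition arc_joining :: "'a::topological_space \<Rightarrow> 'a \<Rightarrow> 'a set \<Rightarrow> bool" where
  "arc_joining x y A \<longleftrightarrow>
     (\<exists>g. arc g \<and> pathstart g = x \<and> pathfinish g = y \<and> path_image g = A)"

definition simple_closed_curve :: "'a::topological_space set \<Rightarrow> bool" where
  "simple_closed_curve C \<longleftrightarrow>
     (\<exists>g. simple_path g \<and> pathfinish g = pathstart g \<and> path_image g = C)"

(* Topological (not differentiable) transversality: near p the pair (A, B) looks like the pair
   of coordinate axes near the origin. In particular p is an endpoint of neither arc. *)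
definition crossing :: "(real^3) set \<Rightarrow> (real^3) set \<Rightarrow> real^3 \<Rightarrow> bool" where
  "crossing A B p \<longleftrightarrow>
     (\<exists>U h k. openin (top_of_set S2) U \<and> p \<in> U \<and>
        homeomorphism U (ball (0::complex) 1) h k \<and> h p = 0 \<and>
        h ` (U \<inter> A) = {z \<in> ball 0 1. Im z = 0} \<and>
        h ` (U \<inter> B) = {z \<in> ball 0 1. Re z = 0})"

(* v places the vertices 0, ..., n - 1 of K_n; E maps an edge {i, j} to the closed arc
   representing it. Values of v and E elsewhere are irrelevant. *)
definition drawing :: "nat \<Rightarrow> (nat \<Rightarrow> real^3) \<Rightarrow> (nat set \<Rightarrow> (real^3) set) \<Rightarrow> bool" where
  "drawing n v E \<longleftrightarrow>
     v ` {..<n} \<subseteq> S2 \<and> inj_on v {..<n} \<and>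
     (\<forall>e \<in> complete_edges n. E e \<subseteq> S2 \<and>
        (\<exists>i j. e = {i, j} \<and> arc_joining (v i) (v j) (E e))) \<and>
     (\<forall>e \<in> complete_edges n. \<forall>k<n. v k \<in> E e \<longrightarrow> k \<in> e) \<and>
     (\<forall>e \<in> complete_edges n. \<forall>f \<in> complete_edges n. e \<noteq> f \<longrightarrow>
        finite (E e \<inter> E f) \<and>
        (\<forall>p \<in> E e \<inter> E f. p \<in> v ` (e \<inter> f) \<or> crossing (E e) (E f) p))"

(* That the common point is a common endpoint or a crossing is part of drawing. *)
definition simple_drawing :: "nat \<Rightarrow> (nat \<Rightarrow> real^3) \<Rightarrow> (nat set \<Rightarrow> (real^3) set) \<Rightarrow> bool" where
  "simple_drawing n v E \<longleftrightarrow>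
     drawing n v E \<and>
     (\<forall>e \<in> complete_edges n. \<forall>f \<in> complete_edges n. e \<noteq> f \<longrightarrow>
        (\<forall>p \<in> E e \<inter> E f. \<forall>q \<in> E e \<inter> E f. p = q))"

definition drawing_points :: "nat \<Rightarrow> (nat \<Rightarrow> real^3) \<Rightarrow> (nat set \<Rightarrow> (real^3) set) \<Rightarrow> (real^3) set" where
  "drawing_points n v E = v ` {..<n} \<union> (\<Union>e \<in> complete_edges n. E e)"

definition faces :: "nat \<Rightarrow> (nat \<Rightarrow> real^3) \<Rightarrow> (nat set \<Rightarrow> (real^3) set) \<Rightarrow> (real^3) set set" where
  "faces n v E = components (S2 - drawing_points n v E)"

end

theory Submission
  imports Defs
begin

text \<open>
  Suppose that \<open>e \<inter> C\<close> is disconnected. Follow \<open>e\<close> from one end to the other: somewhere it leaves \<open>C\<close>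
  and comes back, so it has a subarc \<open>P\<close> that meets \<open>C\<close> in its two ends only. If the ends of \<open>P\<close> are
  the two vertices of \<open>e\<close>, then \<open>e \<inter> C\<close> consists of these vertices. Otherwise some end vertex of \<open>e\<close>
  is not on \<open>P\<close>, and the set \<open>D - P\<close>, where \<open>D\<close> is the union of the drawing, gives a contradiction
  in two ways.

  Topologically, \<open>D - P\<close> is disconnected (\<open>sphere_crosscut_disconnects\<close>). The drawing avoids the
  face \<open>F\<close>, so it lies in the closed domain on the other side of \<open>C\<close>. The arc \<open>P\<close> is a crosscut of
  that domain, and by the theta-curve theorem it separates the two arcs into which its ends divide
  \<open>C\<close>. Projecting from a point of \<open>F\<close> turns this into a statement about the bounded domain of a
  Jordan curve in the plane.

  Combinatorially, \<open>D - P\<close> is connected (\<open>simple_drawing_minus_subarc_connected\<close>). Simplicity says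
  that every edge other than \<open>e\<close> meets \<open>P\<close> in at most one point, so removing \<open>P\<close> leaves every
  remaining point of every edge attached to an end vertex of that edge. Moreover, an edge that shares
  with \<open>e\<close> a vertex off \<open>P\<close> has used up its one common point with \<open>e\<close> there, so it misses \<open>P\<close>;
  since \<open>K_n\<close> is complete and has a third vertex, such edges join all the vertices off \<open>P\<close>.
\<close>

section \<open>Crosscuts of Jordan domains\<close>

text \<open>
  The arc \<open>p\<close> and the two arcs \<open>u\<close>, \<open>r\<close> of the closed curve between the ends of \<open>p\<close> form a theta-curve
  with \<open>p\<close> as its middle arc. Hence the interior of the curve without \<open>p\<close> is the disjoint union of
  the interiors of \<open>u \<union> p\<close> and \<open>r \<union> p\<close>. Their closures have only points of \<open>p\<close> in common, and they
  cover \<open>K\<close>. Both contain points of \<open>K\<close> off \<open>p\<close>, namely the inner points of \<open>u\<close> and of \<open>r\<close>.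
\<close>

lemma plane_crosscut_disconnects:
  fixes c p :: "real \<Rightarrow> complex" and K :: "complex set"
  assumes c: "simple_path c" "pathfinish c = pathstart c"
    and p: "arc p" "path_image p \<inter> path_image c = {pathstart p, pathfinish p}"
    and K: "path_image c \<subseteq> K" "path_image p \<subseteq> K" "K \<inter> outside (path_image c) = {}"
  shows "\<not> connected (K - path_image p)"
proof -
  define a b where "a = pathstart p" and "b = pathfinish p"
  have "a \<noteq> b"
    using arc_distinct_ends[OF p(1)] by (simp add: a_def b_def)
  have "a \<in> path_image c" "b \<in> path_image c"
    using p(2) by (auto simp: a_def b_def)
  then obtain u d where ud: "arc u" "arc d" "pathstart u = a" "pathfinish u = b"
      "pathstart d = b" "pathfinish d = a"
      "path_image u \<inter> path_image d = {a,b}" "path_image u \<union> path_image d = path_image c"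
    using exists_double_arc[OF c] \<open>a \<noteq> b\<close> by metis
  define r where "r = reversepath d"
  have r: "arc r" "pathstart r = a" "pathfinish r = b" "path_image r = path_image d"
    using ud by (simp_all add: r_def arc_reversepath)
  have cover: "inside (path_image c) \<union> outside (path_image c) = - path_image c"
    using Jordan_inside_outside[OF c] by blast
  have endless: "path_image q - {a, b} \<noteq> {}"
    if "arc q" "pathstart q = a" "pathfinish q = b" for q :: "real \<Rightarrow> complex"
    using simple_path_endless[OF arc_imp_simple_path[OF that(1)]] that(2,3) by fastforce
  have pc: "path_image p \<inter> path_image c = {a, b}"
    using p(2) by (simp add: a_def b_def)
  have "path_image p - {a,b} \<subseteq> inside (path_image c)"
    using pc cover K(2,3) by blast
  with endless[OF p(1)] have ne: "path_image p \<inter> inside (path_image u \<union> path_image r) \<noteq> {}"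
    unfolding r(4) ud(8) by (force simp: a_def b_def)
  have up: "path_image u \<inter> path_image p = {a,b}" and rp: "path_image r \<inter> path_image p = {a,b}"
    using pc ud(7,8) r(4) by blast+
  obtain disj: "inside (path_image u \<union> path_image p) \<inter> inside (path_image r \<union> path_image p) = {}"
    and split: "inside (path_image u \<union> path_image p) \<union> inside (path_image r \<union> path_image p)
        \<union> (path_image p - {a,b}) = inside (path_image u \<union> path_image r)"
    using split_inside_simple_closed_curve[of u a b r p] up rp ne ud r p(1) \<open>a \<noteq> b\<close>
    by (metis arc_imp_simple_path a_def b_def)
  \<comment> \<open>By the Jordan curve theorem these sets are the closures of the two halves.\<close>
  have cl: "closed (inside (path_image q \<union> path_image p) \<union> (path_image q \<union> path_image p))"
    if q: "arc q" "pathstart q = a" "pathfinish q = b"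
      "path_image q \<inter> path_image p = {a,b}" for q
  proof -
    have "simple_path (q +++ reversepath p)"
      using q p(1) by (auto simp: simple_path_join_loop_eq arc_reversepath a_def b_def)
    then have "frontier (inside (path_image (q +++ reversepath p))) = path_image (q +++ reversepath p)"
      using Jordan_inside_outside[of "q +++ reversepath p"] q by (simp add: a_def)
    moreover have "path_image (q +++ reversepath p) = path_image q \<union> path_image p"
      using q by (simp add: path_image_join b_def)
    ultimately show ?thesis
      by (metis closure_Un_frontier closed_closure)
  qed
  define A where "A = inside (path_image u \<union> path_image p) \<union> (path_image u \<union> path_image p)"
  define B where "B = inside (path_image r \<union> path_image p) \<union> (path_image r \<union> path_image p)"
  have "closed A" "closed B"
    unfolding A_def B_def using cl ud r up rp by blast+
  moreover have "K - path_image p \<subseteq> A \<union> B"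
  proof -
    have "K \<subseteq> inside (path_image c) \<union> path_image c"
      using K(3) cover by blast
    also have "path_image c = path_image u \<union> path_image r"
      using ud(8) r(4) by simp
    finally show ?thesis
      unfolding split[symmetric] A_def B_def by blast
  qed
  moreover have "A \<inter> B \<inter> (K - path_image p) = {}"
  proof -
    have "inside (path_image c) \<inter> path_image c = {}"
      by (rule inside_no_overlap)
    then have "inside (path_image u \<union> path_image p) \<inter> path_image r = {}"
      "inside (path_image r \<union> path_image p) \<inter> path_image u = {}"
      unfolding ud(8)[symmetric] r(4)[symmetric] split[symmetric] by blast+
    moreover have "path_image u \<inter> path_image r \<subseteq> path_image p"
      using ud(7) r(4) pc by blast
    ultimately show ?thesis
      using disj unfolding A_def B_def by blast
  qed
  moreover have "A \<inter> (K - path_image p) \<noteq> {}"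
    using endless[OF ud(1)] ud(3,4,8) up K(1) unfolding A_def by blast
  moreover have "B \<inter> (K - path_image p) \<noteq> {}"
    using endless[OF r(1)] r(2-4) ud(8) rp K(1) unfolding B_def by blast
  ultimately show ?thesis
    unfolding connected_closed by blast
qed

text \<open>
  The projection from a point \<open>z\<close> of \<open>F\<close> carries \<open>D\<close> into the plane. The preimage of the outer
  domain of the projected curve, with \<open>z\<close> added as its point at infinity, is connected, meets \<open>F\<close>
  in \<open>z\<close> and avoids the frontier of \<open>F\<close>. So it lies in \<open>F\<close>, which means that the image of \<open>D\<close>
  does not meet the outer domain.
\<close>
lemma sphere_crosscut_disconnects:
  fixes D F C :: "(real^3) set" and p :: "real \<Rightarrow> real^3"
  assumes C: "simple_closed_curve C" "C = top_of_set S2 frontier_of F" "C \<subseteq> D"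
    and F: "F \<noteq> {}" "F \<subseteq> S2 - D" and D: "D \<subseteq> S2"
    and p: "arc p" "path_image p \<subseteq> D" "path_image p \<inter> C = {pathstart p, pathfinish p}"
  shows "\<not> connected (D - path_image p)"
proof -
  obtain z where z: "z \<in> F"
    using F(1) by blast
  then have zS: "z \<in> S2" "z \<notin> D"
    using F(2) by blast+
  have "S2 - {z} homeomorphic (UNIV :: complex set)"
    by (rule homeomorphic_punctured_sphere_affine) (use zS in auto)
  then obtain h k where hom: "homeomorphism (S2 - {z}) (UNIV :: complex set) h k"
    unfolding homeomorphic_def by blast
  have DS: "D \<subseteq> S2 - {z}"
    using D zS by blast
  have conth: "continuous_on (S2 - {z}) h" and contk: "continuous_on UNIV k"
    using hom by (simp_all add: homeomorphism_def)
  have kh: "k (h x) = x" if "x \<in> S2 - {z}" for x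
    using hom that by (simp add: homeomorphism_def)
  have hk: "h (k y) = y" for y
    using hom by (simp add: homeomorphism_def)
  have krange: "k y \<in> S2 - {z}" for y
    using hom unfolding homeomorphism_def by (metis UNIV_I image_eqI)
  have injh: "inj_on h (S2 - {z})"
    by (metis inj_onI kh)
  obtain g where g: "simple_path g" "pathfinish g = pathstart g" "path_image g = C"
    using C(1) unfolding simple_closed_curve_def by blast
  have gS: "path_image g \<subseteq> S2 - {z}" and pS: "path_image p \<subseteq> S2 - {z}"
    using g(3) C(3) p(2) DS by auto
  have hg: "simple_path (h \<circ> g)" "pathfinish (h \<circ> g) = pathstart (h \<circ> g)"
    "path_image (h \<circ> g) = h ` C"
    using g conth injh gS
    by (auto intro!: simple_path_continuous_image intro: continuous_on_subset inj_on_subset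
        simp: path_image_compose pathfinish_compose pathstart_compose)
  have hp: "arc (h \<circ> p)" "path_image (h \<circ> p) = h ` path_image p"
    using p(1) conth injh pS
    by (auto simp: arc_def path_image_def path_image_compose
        intro!: path_continuous_image comp_inj_on intro: continuous_on_subset inj_on_subset)
  let ?O = "outside (h ` C)"
  have O: "connected ?O" "\<not> bounded ?O"
    using Jordan_inside_outside[OF hg(1,2)] unfolding hg(3) by auto
  \<comment> \<open>Otherwise the unbounded outer domain would lie in the image of a compact subset of the
      punctured sphere.\<close>
  have "z \<in> closure (k ` ?O)"
  proof (rule ccontr)
    assume "z \<notin> closure (k ` ?O)"
    moreover have "closure (k ` ?O) \<subseteq> S2"
      using krange by (intro closure_minimal) auto
    ultimately have sub: "closure (k ` ?O) \<subseteq> S2 - {z}"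
      by blast
    have "bounded (k ` ?O)"
      using krange by (intro bounded_subset[OF bounded_sphere]) blast
    then have "compact (h ` closure (k ` ?O))"
      using continuous_on_subset[OF conth sub] by (intro compact_continuous_image) auto
    moreover have "?O \<subseteq> h ` closure (k ` ?O)"
    proof
      fix y
      assume "y \<in> ?O"
      then have "k y \<in> closure (k ` ?O)"
        by (intro closure_subset[THEN subsetD] imageI)
      then show "y \<in> h ` closure (k ` ?O)"
        using hk[of y] by (metis imageI)
    qed
    ultimately show False
      using O(2) bounded_subset compact_imp_bounded by blast
  qed
  then have "insert z (k ` ?O) \<subseteq> closure (k ` ?O)"
    using closure_subset[of "k ` ?O"] by blast
  moreover have "connected (k ` ?O)"
    by (rule connected_continuous_image[OF continuous_on_subset[OF contk] O(1)]) simp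
  ultimately have con: "connected (insert z (k ` ?O))"
    using connected_intermediate_closure[of "k ` ?O"] by blast
  have "insert z (k ` ?O) \<inter> C = {}"
  proof -
    have "y \<in> h ` C" if "k y \<in> C" for y
      using that hk[of y] by (metis imageI)
    then show ?thesis
      using zS C(3) outside_no_overlap[of "h ` C"] by blast
  qed
  then have sub: "insert z (k ` ?O) \<subseteq> F"
  proof -
    have "connectedin (top_of_set S2) (insert z (k ` ?O))"
      using con zS(1) krange unfolding connectedin_subtopology connectedin_iff_connected by blast
    then show ?thesis
      using connectedin_Int_frontier_of[of "top_of_set S2" "insert z (k ` ?O)" F] z
        \<open>insert z (k ` ?O) \<inter> C = {}\<close> unfolding C(2)[symmetric] by blast
  qed
  have "\<not> connected (h ` D - path_image (h \<circ> p))"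
  proof (rule plane_crosscut_disconnects[OF hg(1,2) hp(1)])
    show "path_image (h \<circ> p) \<inter> path_image (h \<circ> g) = {pathstart (h \<circ> p), pathfinish (h \<circ> p)}"
    proof -
      have "h ` path_image p \<inter> h ` C = h ` (path_image p \<inter> C)"
        using inj_on_image_Int[OF injh pS] gS g(3) by metis
      then show ?thesis
        unfolding hp(2) hg(3) p(3) by (simp add: pathfinish_compose pathstart_compose)
    qed
    show "path_image (h \<circ> g) \<subseteq> h ` D" "path_image (h \<circ> p) \<subseteq> h ` D"
      unfolding hp(2) hg(3) using C(3) p(2) by blast+
    show "h ` D \<inter> outside (path_image (h \<circ> g)) = {}"
    proof -
      have "h x \<notin> ?O" if "x \<in> D" for x
      proof
        assume "h x \<in> ?O"
        then have "x \<in> k ` ?O"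
          using kh[of x] that DS by (metis imageI subsetD)
        then show False
          using that sub F(2) by blast
      qed
      then show ?thesis
        unfolding hg(3) by blast
    qed
  qed
  moreover have "h ` D - path_image (h \<circ> p) = h ` (D - path_image p)"
    unfolding hp(2) using inj_on_image_set_diff[OF injh, of D "path_image p"] DS pS by blast
  moreover have "continuous_on (D - path_image p) h"
    using DS by (intro continuous_on_subset[OF conth]) blast
  ultimately show ?thesis
    using connected_continuous_image by metis
qed

section \<open>Removing a subarc of an edge from a simple drawing\<close>

lemma drawing_edge_arc:
  assumes "drawing n v E" "f \<in> complete_edges n"
  obtains g i j where "arc g" "path_image g = E f" "g 0 = v i" "g 1 = v j" "f = {i, j}"
    "i < n" "j < n" "i \<noteq> j"
proof -
  have "\<forall>e \<in> complete_edges n. E e \<subseteq> S2 \<and> (\<exists>i j. e = {i, j} \<and> arc_joining (v i) (v j) (E e))"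
    using assms(1) by (simp add: drawing_def)
  then obtain i j where f: "f = {i, j}" and "arc_joining (v i) (v j) (E f)"
    using assms(2) by blast
  then obtain g where "arc g" "path_image g = E f" "g 0 = v i" "g 1 = v j"
    unfolding arc_joining_def pathstart_def pathfinish_def by blast
  moreover have "i < n" "j < n" "i \<noteq> j"
    using assms(2) unfolding f complete_edges_def by auto
  ultimately show thesis
    using that f by blast
qed

text \<open>
  The parameters of the removed points form an interval, so the path can be followed away from that
  interval. With \<open>a > b\<close> this covers the case that nothing is removed, and with \<open>a = b\<close> the
  removal of a single point.
\<close>
lemma path_reaches_end_off_interval:
  fixes g :: "real \<Rightarrow> 'a::real_normed_vector"
  assumes "path g" and P: "\<And>t. \<lbrakk>0 \<le> t; t \<le> 1\<rbrakk> \<Longrightarrow> g t \<in> P \<longleftrightarrow> a \<le> t \<and> t \<le> b"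
    and x: "x \<in> path_image g - P"
  shows "connected_component (path_image g - P) x (g 0) \<or> connected_component (path_image g - P) x (g 1)"
proof -
  obtain t where t: "0 \<le> t" "t \<le> 1" "x = g t"
    using x by (auto simp: path_image_def)
  have contg: "continuous_on {0..1} g"
    using assms(1) by (simp add: path_def)
  have con: "connected (g ` {c..d})" if "0 \<le> c" "d \<le> 1" for c d
    using that by (intro connected_continuous_image continuous_on_subset[OF contg]) auto
  have "t < a \<or> b < t"
    using P[OF t(1,2)] x t(3) by auto
  then show ?thesis
  proof
    assume "t < a"
    then have "g ` {0..t} \<subseteq> path_image g - P"
      using P t by (auto simp: path_image_def)
    with con[of 0 t] t have "connected_component (path_image g - P) x (g 0)"
      unfolding connected_component_def by (intro exI[of _ "g ` {0..t}"]) auto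
    then show ?thesis ..
  next
    assume "b < t"
    then have "g ` {t..1} \<subseteq> path_image g - P"
      using P t by (auto simp: path_image_def)
    with con[of t 1] t have "connected_component (path_image g - P) x (g 1)"
      unfolding connected_component_def by (intro exI[of _ "g ` {t..1}"]) auto
    then show ?thesis ..
  qed
qed

text \<open>
  Everything is joined to the vertex \<open>w\<close> of \<open>e\<close>, which is off the subarc. A vertex outside \<open>e\<close> is
  joined to \<open>w\<close> by an edge that meets \<open>e\<close> in \<open>w\<close> only. If the other vertex of \<open>e\<close> is off the subarc
  too, it is joined to \<open>w\<close> through a third vertex, as \<open>e\<close> itself is interrupted; this is where
  \<open>n \<ge> 3\<close> enters. From any other point one reaches a vertex off the subarc along an edge.
\<close>
lemma simple_drawing_minus_subarc_connected:
  assumes "n \<ge> 3" and sd: "simple_drawing n v E" and e: "e \<in> complete_edges n"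
    and g: "arc g" "path_image g = E e" "g 0 \<in> v ` {..<n}" "g 1 \<in> v ` {..<n}"
    and ab: "0 \<le> a" "b \<le> 1"
    and w: "w \<in> e" "v w \<notin> g ` {a..b}"
  shows "connected (drawing_points n v E - g ` {a..b})"
proof -
  define P where "P = g ` {a..b}"
  define D where "D = drawing_points n v E"
  have dr: "drawing n v E"
    using sd by (simp add: simple_drawing_def)
  have PE: "P \<subseteq> E e"
    using g(2) ab by (auto simp: P_def path_image_def)
  have ED: "E f \<subseteq> D" if "f \<in> complete_edges n" for f
    using that by (auto simp: D_def drawing_points_def)
  have once: "x = y" if "f \<in> complete_edges n" "f \<noteq> e" "x \<in> E f \<inter> E e" "y \<in> E f \<inter> E e" for f x y
    using sd e that unfolding simple_drawing_def by blast
  have vE: "v k \<in> E f" if f: "f \<in> complete_edges n" and k: "k \<in> f" for f k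
  proof -
    obtain q i j where q: "path_image q = E f" "q 0 = v i" "q 1 = v j" "f = {i, j}"
      using drawing_edge_arc[OF dr f] by metis
    have "q 0 \<in> E f" "q 1 \<in> E f"
      unfolding q(1)[symmetric] path_image_def by auto
    then show ?thesis
      using k q by auto
  qed
  obtain u where u: "e = {u, w}" "u \<noteq> w" "u < n"
    using drawing_edge_arc[OF dr e] w(1) by (metis doubleton_eq_iff insertE singletonD)
  have vP: "k = u" if "k < n" "v k \<in> P" for k
  proof -
    have "\<forall>e \<in> complete_edges n. \<forall>k<n. v k \<in> E e \<longrightarrow> k \<in> e"
      using dr by (simp add: drawing_def)
    then have "k \<in> e"
      using e that PE by blast
    then show ?thesis
      using u(1) w(2) that(2) by (auto simp: P_def)
  qed
  \<comment> \<open>An edge that shares with \<open>e\<close> a vertex off the removed subarc is disjoint from that subarc.\<close>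
  have adj: "connected_component (D - P) (v k) (v l)"
    if kl: "k \<in> e" "v k \<notin> P" "l < n" "l \<notin> e" for k l
  proof -
    have f: "{k, l} \<in> complete_edges n" "{k, l} \<noteq> e"
      using kl e by (auto simp: complete_edges_def card_insert_if)
    have "E {k, l} \<inter> P = {}"
      using once[OF f, of "v k"] vE[OF f(1)] vE[OF e kl(1)] kl(2) PE by fastforce
    moreover have "connected (E {k, l})"
      using drawing_edge_arc[OF dr f(1)] by (metis connected_arc_image)
    ultimately show ?thesis
      unfolding connected_component_def using ED[OF f(1)] vE[OF f(1)]
      by (intro exI[of _ "E {k, l}"]) blast
  qed
  have vw: "connected_component (D - P) (v k) (v w)" if k: "k < n" "v k \<notin> P" for k
  proof -
    consider "k = w" | "k = u" | "k \<notin> e"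
      using u(1) by blast
    then show ?thesis
    proof cases
      case 1
      have "v w \<in> D - P"
        using ED[OF e] vE[OF e w(1)] w(2) by (auto simp: P_def)
      with 1 show ?thesis
        by (simp add: connected_component_refl)
    next
      case 2
      have "card e = 2"
        using e by (simp add: complete_edges_def)
      then have "\<not> {..<n} \<subseteq> e"
        using \<open>n \<ge> 3\<close> card_mono[of e "{..<n}"] u(1) by auto
      then obtain l where l: "l < n" "l \<notin> e"
        by blast
      show ?thesis
        using adj[of k l] adj[of w l] 2 l k u(1) w P_def
        by (metis connected_component_sym connected_component_trans insertI1)
    next
      case 3
      then show ?thesis
        using adj[of w k] w k(1) by (simp add: P_def connected_component_sym)
    qed
  qed
  have edge: "connected_component (D - P) x (v w)" if f: "f \<in> complete_edges n" and x: "x \<in> E f - P" for f x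
  proof -
    \<comment> \<open>On every edge the removed parameters form an interval: the given one on \<open>e\<close>, and at most
        one point on any other edge, since that edge meets \<open>e\<close> at most once.\<close>
    have "\<exists>q i j c d. arc q \<and> path_image q = E f \<and> q 0 = v i \<and> q 1 = v j \<and> i < n \<and> j < n \<and>
        (\<forall>t. 0 \<le> t \<longrightarrow> t \<le> 1 \<longrightarrow> (q t \<in> P \<longleftrightarrow> c \<le> t \<and> t \<le> d))"
    proof (cases "f = e")
      case True
      obtain i j where ij: "g 0 = v i" "g 1 = v j" "i < n" "j < n"
        using g(3,4) by auto
      have "g t \<in> P \<longleftrightarrow> a \<le> t \<and> t \<le> b" if "0 \<le> t" "t \<le> 1" for t
        using that ab g(1) unfolding P_def arc_def inj_on_def by fastforce
      then show ?thesis
        using ij g True by blast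
    next
      case False
      obtain q i j where q: "arc q" "path_image q = E f" "q 0 = v i" "q 1 = v j" "i < n" "j < n"
        using drawing_edge_arc[OF dr f] by metis
      have one: "t = t'" if "0 \<le> t" "t \<le> 1" "q t \<in> P" "0 \<le> t'" "t' \<le> 1" "q t' \<in> P" for t t'
      proof -
        have "q t \<in> E f" "q t' \<in> E f"
          using that q(2) by (auto simp: path_image_def)
        then have "q t = q t'"
          using once[OF f False] that PE by blast
        then show ?thesis
          using q(1) that unfolding arc_def inj_on_def by auto
      qed
      have "\<exists>c d. \<forall>t. 0 \<le> t \<longrightarrow> t \<le> 1 \<longrightarrow> (q t \<in> P \<longleftrightarrow> c \<le> t \<and> t \<le> d)"
      proof (cases "\<exists>s. 0 \<le> s \<and> s \<le> 1 \<and> q s \<in> P")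
        case True
        then obtain s where "0 \<le> s" "s \<le> 1" "q s \<in> P"
          by blast
        then have "\<forall>t. 0 \<le> t \<longrightarrow> t \<le> 1 \<longrightarrow> (q t \<in> P \<longleftrightarrow> s \<le> t \<and> t \<le> s)"
          using one by (metis antisym order_refl)
        then show ?thesis
          by blast
      next
        case False
        then show ?thesis
          \<comment> \<open>an empty interval\<close>
          by (intro exI[of _ 1] exI[of _ 0]) auto
      qed
      then show ?thesis
        using q by blast
    qed
    then obtain q i j c d where q: "arc q" "path_image q = E f" "q 0 = v i" "q 1 = v j" "i < n" "j < n"
      "\<And>t. \<lbrakk>0 \<le> t; t \<le> 1\<rbrakk> \<Longrightarrow> q t \<in> P \<longleftrightarrow> c \<le> t \<and> t \<le> d"
      by metis
    then have "connected_component (E f - P) x (v i) \<or> connected_component (E f - P) x (v j)"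
      using path_reaches_end_off_interval[of q P c d x] x by (simp add: arc_imp_path)
    then obtain k where k: "k < n" "connected_component (E f - P) x (v k)"
      using q(5,6) by blast
    then have "connected_component (D - P) x (v k)" "v k \<notin> P"
      using connected_component_of_subset[OF k(2), of "D - P"] ED[OF f] connected_component_in by blast+
    then show ?thesis
      using vw k(1) connected_component_trans by metis
  qed
  have "connected_component (D - P) x (v w)" if "x \<in> D - P" for x
    using that edge vw unfolding D_def drawing_points_def by blast
  then show ?thesis
    unfolding D_def[symmetric] P_def[symmetric] connected_iff_connected_component
    by (metis connected_component_sym connected_component_trans)
qed

section \<open>Edges along the boundary of a face\<close>

lemma closed_set_gap:
  fixes T :: "real set"
  assumes "closed T" "s \<in> T" "t \<in> T" "r \<notin> T" "s < r" "r < t"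
  obtains a b where "s \<le> a" "a < b" "b \<le> t" "T \<inter> {a..b} = {a, b}"
proof -
  have "compact (T \<inter> {s..r})" "compact (T \<inter> {r..t})"
    using assms(1) by (simp_all add: closed_Int_compact)
  moreover have "T \<inter> {s..r} \<noteq> {}" "T \<inter> {r..t} \<noteq> {}"
    using assms by auto
  ultimately obtain a b where a: "a \<in> T \<inter> {s..r}" "\<And>x. x \<in> T \<inter> {s..r} \<Longrightarrow> x \<le> a"
    and b: "b \<in> T \<inter> {r..t}" "\<And>x. x \<in> T \<inter> {r..t} \<Longrightarrow> b \<le> x"
    using compact_attains_sup[of "T \<inter> {s..r}"] compact_attains_inf[of "T \<inter> {r..t}"] by metis
  have only: "x = a \<or> x = b" if "x \<in> T" "a \<le> x" "x \<le> b" for x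
    using that a b by (metis IntI antisym atLeastAtMost_iff le_cases order_trans Int_iff)
  moreover have "a < b"
    using a(1) b(1) assms(4) by (metis IntE antisym atLeastAtMost_iff not_less order_trans)
  moreover have "T \<inter> {a..b} = {a, b}"
    using calculation a(1) b(1) only by (auto dest: only)
  ultimately show thesis
    using that[of a b] a(1) b(1) by auto
qed

text \<open>
  The sphere is locally connected and the drawing is compact. So a face is open in the sphere, and
  it is relatively closed in the complement of the drawing.
\<close>
lemma face_frontier_subset:
  fixes v E n
  defines "D \<equiv> drawing_points n v E"
  assumes dr: "drawing n v E" and F: "F \<in> faces n v E"
  shows "top_of_set S2 frontier_of F \<subseteq> D"
proof -
  have "finite (complete_edges n)"
    by (rule finite_subset[of _ "Pow {..<n}"]) (auto simp: complete_edges_def)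
  moreover have "closed (E f)" if "f \<in> complete_edges n" for f
    using drawing_edge_arc[OF dr that] by (metis closed_arc_image)
  ultimately have "closed D"
    unfolding D_def drawing_points_def by (intro closed_Un closed_UN finite_imp_closed) auto
  then have U: "openin (top_of_set S2) (S2 - D)"
    by (metis Diff_eq open_Compl openin_open_Int)
  have Fc: "F \<in> components (S2 - D)"
    using F by (simp add: faces_def D_def)
  have "openin (top_of_set S2) F"
    using openin_components_locally_connected[OF locally_open_subset[OF locally_connected_sphere U] Fc]
      U openin_trans by blast
  then have "top_of_set S2 frontier_of F = top_of_set S2 closure_of F - F"
    by (simp add: frontier_of_def interior_of_openin)
  also have "\<dots> = S2 \<inter> closure F - F"
  proof -
    have "S2 \<inter> F = F"
      using in_components_subset[OF Fc] by blast
    then show ?thesis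
      by (simp add: closure_of_subtopology)
  qed
  also have "\<dots> \<subseteq> D"
  proof -
    obtain T where T: "closed T" "F = (S2 - D) \<inter> T"
      using closedin_component[OF Fc] closedin_closed by metis
    then have "closure F \<subseteq> T"
      by (intro closure_minimal) auto
    then show ?thesis
      using T(2) by blast
  qed
  finally show ?thesis .
qed

theorem theorem1:
  fixes n :: nat
    and v :: "nat \<Rightarrow> real^3"
    and E :: "nat set \<Rightarrow> (real^3) set"
    and F C :: "(real^3) set"
    and e :: "nat set"
  assumes "n \<ge> 3"
    and "simple_drawing n v E"
    and "F \<in> faces n v E"
    and "simple_closed_curve C"
    and "C = top_of_set S2 frontier_of F"
    and "e \<in> complete_edges n"
  shows "connected (E e \<inter> C) \<or> E e \<inter> C = v ` e"
proof (rule ccontr)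
  assume "\<not> ?thesis"
  then have ncon: "\<not> connected (E e \<inter> C)" and nends: "E e \<inter> C \<noteq> v ` e"
    by blast+
  have dr: "drawing n v E"
    using assms(2) by (simp add: simple_drawing_def)
  obtain g i j where g: "arc g" "path_image g = E e" "g 0 = v i" "g 1 = v j" "e = {i, j}"
      "i < n" "j < n" "i \<noteq> j"
    using drawing_edge_arc[OF dr assms(6)] by metis
  have contg: "continuous_on {0..1} g" and injg: "inj_on g {0..1}"
    using g(1) by (auto simp: arc_def path_def)
  obtain c where "path c" "path_image c = C"
    using assms(4) unfolding simple_closed_curve_def by (metis simple_path_imp_path)
  then have "closed C"
    using closed_path_image by blast
  define T where "T = {0..1} \<inter> g -` C"
  have "closed T"
    unfolding T_def by (rule continuous_closed_preimage[OF contg _ \<open>closed C\<close>]) simp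
  have EC: "E e \<inter> C = g ` T"
    unfolding T_def g(2)[symmetric] path_image_def by blast
  then have "\<not> connected T"
    using ncon connected_continuous_image[OF continuous_on_subset[OF contg]] by (metis T_def inf_le1)
  then obtain s t r where "s \<in> T" "t \<in> T" "r \<notin> T" "s < r" "r < t"
    by (metis connected_iff_interval order_le_less)
  then obtain a b where st: "s \<le> a" "b \<le> t" and ab: "a < b" and gap: "T \<inter> {a..b} = {a, b}"
    using closed_set_gap[OF \<open>closed T\<close>] by metis
  have aT: "a \<in> T" "b \<in> T"
    using gap by blast+
  then have a01: "0 \<le> a" "a \<le> 1" "0 \<le> b" "b \<le> 1"
    by (auto simp: T_def)
  define p where "p = subpath a b g"
  have p: "arc p" "path_image p = g ` {a..b}" "pathstart p = g a" "pathfinish p = g b"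
    unfolding p_def using arc_subpath_arc[OF g(1)] a01 ab injg
    by (auto simp: path_image_subpath)
  have "g ` {a..b} \<inter> C = g ` (T \<inter> {a..b})"
    using a01 by (auto simp: T_def)
  then have pC: "path_image p \<inter> C = {pathstart p, pathfinish p}"
    using gap p by simp
  \<comment> \<open>A gap that is all of the parameter interval would make \<open>e \<inter> C\<close> the pair of end vertices.\<close>
  have "a \<noteq> 0 \<or> b \<noteq> 1"
  proof (rule ccontr)
    assume "\<not> ?thesis"
    then have "T = {0, 1}"
      using gap by (auto simp: T_def)
    then show False
      using nends EC g(3-5) by auto
  qed
  then obtain w where w: "w \<in> e" "v w \<notin> g ` {a..b}"
  proof
    assume "a \<noteq> 0"
    then have "g 0 \<notin> g ` {a..b}"
      using inj_on_image_mem_iff[OF injg, of 0 "{a..b}"] a01 by auto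
    then show thesis
      using that g(3,5) by auto
  next
    assume "b \<noteq> 1"
    then have "g 1 \<notin> g ` {a..b}"
      using inj_on_image_mem_iff[OF injg, of 1 "{a..b}"] a01 by auto
    then show thesis
      using that g(4,5) by auto
  qed
  have ends: "g 0 \<in> v ` {..<n}" "g 1 \<in> v ` {..<n}"
    using g(3,4,6,7) by auto
  have "connected (drawing_points n v E - path_image p)"
    unfolding p(2)
    by (rule simple_drawing_minus_subarc_connected[OF assms(1,2,6) g(1,2) ends a01(1) a01(4) w])
  moreover have "\<not> connected (drawing_points n v E - path_image p)"
  proof -
    have CD: "C \<subseteq> drawing_points n v E"
      using face_frontier_subset[OF dr assms(3)] assms(5) by simp
    have F: "F \<noteq> {}" "F \<subseteq> S2 - drawing_points n v E"
      using assms(3) unfolding faces_def by (auto dest: in_components_nonempty in_components_subset)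
    have DS: "drawing_points n v E \<subseteq> S2"
    proof -
      have "v ` {..<n} \<subseteq> S2" "\<forall>f \<in> complete_edges n. E f \<subseteq> S2"
        using dr by (simp_all add: drawing_def)
      then show ?thesis
        unfolding drawing_points_def by blast
    qed
    have pD: "path_image p \<subseteq> drawing_points n v E"
    proof -
      have "g ` {a..b} \<subseteq> g ` {0..1}"
        using a01 by (intro image_mono) auto
      also have "\<dots> = E e"
        using g(2) by (simp add: path_image_def)
      also have "\<dots> \<subseteq> drawing_points n v E"
        using assms(6) by (auto simp: drawing_points_def)
      finally show ?thesis
        unfolding p(2) .
    qed
    show ?thesis
      by (rule sphere_crosscut_disconnects[OF assms(4,5) CD F DS p(1) pD pC])
  qed
  ultimately show False
    by contradiction
qed

end
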